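(* Let $G=(V,E)$ be a finite tree with positive real edge lengths $\{\alpha_e: e\in E\}$ and distance matrix $D$. (a) For a nonempty subset $S\subseteq V$, \[ \frac{\det D[S]}{\operatorname{cof} D[S]} \le \frac12\sum_{e\in E(\operatorname{conv}(S,G))}\alpha_e . \] (b) If $S\subseteq V$ and $\gamma$ is a simple path in $G$ between vertices $s_0,s_1\in S$, then \[ \frac12\sum_{e\in\gamma}\alpha_e \le \frac{\det D[S]}{\operatorname{cof} D[S]}. \]
   Context: The distance matrix $D$ has $(u,v)$-entry equal to the sum of $\alpha_e$ along the unique path from $u$ to $v$; $D[S]$ is the principal submatrix indexed by $S$. For a $k\times k$ matrix $M$, $\operatorname{cof} M=\sum_{i,j}(-1)^{i+j}\det M_{i,j}$ with $M_{i,j}$ obtained by deleting row $i$ and column $j$ (for $k=1$, $\operatorname{cof}M=1$). $\operatorname{conv}(S,G)$ is the convex hull of $S$: the subtree of $G$ consisting of the union of all paths between vertices of $S$. *)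

theory Defs
  imports
    "Jordan_Normal_Form.Determinant"
    "Jordan_Normal_Form.DL_Submatrix"
begin

record 'a ugraph =
  verts :: "'a set"
  edges :: "'a set set"

definition simple_graph :: "'a ugraph \<Rightarrow> bool" where
  "simple_graph G \<longleftrightarrow> (\<forall>e\<in>edges G. \<exists>u v. u \<in> verts G \<and> v \<in> verts G \<and> u \<noteq> v \<and> e = {u, v})"

text \<open>A simple path is given by its list of vertices, so that the one-vertex lists
  are the paths of length zero.\<close>

definition simple_path :: "'a ugraph \<Rightarrow> 'a \<Rightarrow> 'a list \<Rightarrow> 'a \<Rightarrow> bool" where
  "simple_path G u p v \<longleftrightarrow>
     p \<noteq> [] \<and> hd p = u \<and> last p = v \<and> distinct p \<and> set p \<subseteq> verts G \<and>
     (\<forall>i. Suc i < length p \<longrightarrow> {p ! i, p ! Suc i} \<in> edges G)"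

definition path_edges :: "'a list \<Rightarrow> 'a set set" where
  "path_edges p = {{p ! i, p ! Suc i} | i. Suc i < length p}"

definition connected_graph :: "'a ugraph \<Rightarrow> bool" where
  "connected_graph G \<longleftrightarrow> (\<forall>u\<in>verts G. \<forall>v\<in>verts G. \<exists>p. simple_path G u p v)"

text \<open>A cycle is a simple path on at least three vertices together with the edge
  joining its two ends.\<close>

definition acyclic_graph :: "'a ugraph \<Rightarrow> bool" where
  "acyclic_graph G \<longleftrightarrow>
     \<not> (\<exists>u v c. simple_path G u c v \<and> 3 \<le> length c \<and> {v, u} \<in> edges G)"

definition finite_tree :: "'a ugraph \<Rightarrow> bool" where
  "finite_tree G \<longleftrightarrow>
     simple_graph G \<and> finite (verts G) \<and> verts G \<noteq> {} \<and>
     connected_graph G \<and> acyclic_graph G"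

definition tree_dist :: "'a ugraph \<Rightarrow> ('a set \<Rightarrow> real) \<Rightarrow> 'a \<Rightarrow> 'a \<Rightarrow> real" where
  "tree_dist G \<alpha> u v = (\<Sum>e\<in>path_edges (THE p. simple_path G u p v). \<alpha> e)"

text \<open>Matrices are indexed by natural numbers, so a vertex set is accompanied by an
  enumeration \<open>vs\<close> (a duplicate-free list of all vertices). Row and column \<open>i\<close> belong
  to the vertex \<open>vs ! i\<close>.\<close>

definition distance_matrix :: "'a ugraph \<Rightarrow> ('a set \<Rightarrow> real) \<Rightarrow> 'a list \<Rightarrow> real mat" where
  "distance_matrix G \<alpha> vs =
     mat (length vs) (length vs) (\<lambda>(i, j). tree_dist G \<alpha> (vs ! i) (vs ! j))"

definition principal_submatrix :: "'b mat \<Rightarrow> 'a list \<Rightarrow> 'a set \<Rightarrow> 'b mat" where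
  "principal_submatrix M vs S =
     (let I = {i. i < length vs \<and> vs ! i \<in> S} in submatrix M I I)"

text \<open>The sum of all cofactors. For a \<open>1 \<times> 1\<close> matrix it equals \<open>1\<close>, since the determinant of
  the \<open>0 \<times> 0\<close> matrix is \<open>1\<close>. The sign \<open>(-1)^(i+j)\<close> in \<^const>\<open>cofactor\<close> is the same for
  indices starting at \<open>0\<close> and at \<open>1\<close>.\<close>

definition cof :: "'b :: comm_ring_1 mat \<Rightarrow> 'b" where
  "cof M = (\<Sum>i<dim_row M. \<Sum>j<dim_col M. cofactor M i j)"

definition conv_hull :: "'a set \<Rightarrow> 'a ugraph \<Rightarrow> 'a ugraph" where
  "conv_hull S G =
     \<lparr>verts = \<Union> {set p | p. \<exists>u\<in>S. \<exists>v\<in>S. simple_path G u p v},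
      edges = \<Union> {path_edges p | p. \<exists>u\<in>S. \<exists>v\<in>S. simple_path G u p v}\<rparr>"

end

theory Submission
  imports Defs
begin

text \<open>Both bounds come from a variational description: \<open>det D[S] / cof D[S]\<close> is the maximum of the
  quadratic form \<open>x\<^sup>T D[S] x\<close> over vectors \<open>x\<close> with entry sum \<open>1\<close>. Deleting an edge \<open>e\<close> splits the
  tree into two sides; if \<open>X\<^sub>e\<close> is the weight of \<open>x\<close> on one of them and \<open>T\<close> the total weight, then
  \<open>x\<^sup>T D x = 2 \<Sum>\<^sub>e \<alpha>\<^sub>e X\<^sub>e (T - X\<^sub>e)\<close>. For \<open>T = 0\<close> this is negative unless \<open>x = 0\<close>, so the critical
  point is a maximum. For \<open>T = 1\<close> each summand is at most \<open>\<alpha>\<^sub>e / 4\<close>, and it vanishes when \<open>e\<close> lies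
  outside the convex hull, which gives (a). Putting weight \<open>1/2\<close> on both \<open>s0\<close> and \<open>s1\<close> gives (b).\<close>

section \<open>Edge sets of paths and uniqueness of simple paths in acyclic graphs\<close>

lemma path_edges_simps [simp]:
  "path_edges [] = {}"
  "path_edges [a] = {}"
  "path_edges (a # b # p) = insert {a, b} (path_edges (b # p))"
proof -
  show "path_edges (a # b # p) = insert {a, b} (path_edges (b # p))"
  proof (intro equalityI subsetI)
    fix e assume "e \<in> path_edges (a # b # p)"
    then obtain i where i: "Suc i < length (a # b # p)"
      "e = {(a # b # p) ! i, (a # b # p) ! Suc i}"
      by (auto simp: path_edges_def)
    then show "e \<in> insert {a, b} (path_edges (b # p))"
      by (cases i) (auto simp: path_edges_def)
  next
    fix e assume "e \<in> insert {a, b} (path_edges (b # p))"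
    then consider "e = {a, b}"
      | i where "Suc i < length (b # p)" "e = {(b # p) ! i, (b # p) ! Suc i}"
      by (auto simp: path_edges_def)
    then show "e \<in> path_edges (a # b # p)"
    proof cases
      case 1
      then show ?thesis by (auto simp: path_edges_def intro!: exI[of _ 0])
    next
      case (2 i)
      then show ?thesis unfolding path_edges_def
        by (intro CollectI exI[of _ "Suc i"]) simp
    qed
  qed
qed (auto simp: path_edges_def)

lemma path_edges_Cons:
  "p \<noteq> [] \<Longrightarrow> path_edges (a # p) = insert {a, hd p} (path_edges p)"
  by (cases p) auto

lemma path_edges_append:
  "p \<noteq> [] \<Longrightarrow> q \<noteq> [] \<Longrightarrow>
    path_edges (p @ q) = insert {last p, hd q} (path_edges p \<union> path_edges q)"
  by (induction p) (auto simp: path_edges_Cons)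

lemma path_edges_rev: "path_edges (rev p) = path_edges p"
proof (induction p)
  case (Cons a p)
  then show ?case
    by (cases "p = []") (auto simp: path_edges_append path_edges_Cons last_rev insert_commute)
qed simp

lemma path_edges_subset_set: "e \<in> path_edges p \<Longrightarrow> e \<subseteq> set p"
  by (auto simp: path_edges_def)

lemma simple_path_iff:
  "simple_path G u p v \<longleftrightarrow>
    p \<noteq> [] \<and> hd p = u \<and> last p = v \<and> distinct p \<and> set p \<subseteq> verts G \<and> path_edges p \<subseteq> edges G"
  unfolding simple_path_def path_edges_def by blast

text \<open>Two simple paths with common ends that part after \<open>u\<close> must meet again.
  Following one to the first meeting point and returning along the other to the neighbour
  \<open>hd q'\<close> of \<open>u\<close> gives a path that the edge \<open>{hd q', u}\<close>
  closes to a cycle.\<close>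

lemma acyclic_simple_path_unique:
  assumes "acyclic_graph G"
  shows "simple_path G u p v \<Longrightarrow> simple_path G u q v \<Longrightarrow> p = q"
proof (induction p arbitrary: u q)
  case Nil
  then show ?case by (simp add: simple_path_iff)
next
  case (Cons x p)
  then obtain q' where q: "q = u # q'" and x: "x = u"
    by (cases q) (auto simp: simple_path_iff)
  show ?case
  proof (cases "p = [] \<or> q' = []")
    case True
    then show ?thesis using Cons.prems unfolding q x
      by (auto simp: simple_path_iff split: if_splits)
  next
    case False
    have p': "simple_path G (hd p) p v" and q': "simple_path G (hd q') q' v"
      and u: "u \<notin> set p" "u \<notin> set q'" "u \<in> verts G"
      and e: "{u, hd p} \<in> edges G" "{u, hd q'} \<in> edges G"
      using Cons.prems False unfolding q x by (auto simp: simple_path_iff path_edges_Cons)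
    show ?thesis
    proof (cases "hd p = hd q'")
      case True
      then show ?thesis using Cons.IH[OF p'] q' q x by auto
    next
      case neq: False
      have "last p = last q'" using p' q' by (simp add: simple_path_iff)
      then have "\<exists>z\<in>set p. z \<in> set q'" using False last_in_set by metis
      \<comment> \<open>Choosing the first vertex of \<open>p\<close> on \<open>q'\<close> keeps
        \<open>p1\<close> disjoint from \<open>q'\<close>, which makes the list \<open>?c\<close>
        below duplicate-free.\<close>
      then obtain p1 z p2 where p: "p = p1 @ z # p2" and z: "z \<in> set q'"
        and p1: "\<forall>y\<in>set p1. y \<notin> set q'"
        using split_list_first_prop[of p "\<lambda>y. y \<in> set q'"] by blast
      from z obtain q1 q2 where q1: "q' = q1 @ z # q2" by (meson split_list)
      let ?c = "u # p1 @ z # rev q1"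
      have prefix: "path_edges (xs @ [z]) \<subseteq> path_edges (xs @ z # ys)" for xs ys
        using path_edges_append[of "xs @ [z]" ys] by (cases "ys = []") auto
      have "path_edges p \<subseteq> edges G" "path_edges q' \<subseteq> edges G"
        using p' q' by (simp_all add: simple_path_iff)
      then have pe: "path_edges (p1 @ [z]) \<subseteq> edges G" "path_edges (q1 @ [z]) \<subseteq> edges G"
        unfolding p q1 using prefix by blast+
      have "path_edges (z # rev q1) \<subseteq> edges G"
        using pe(2) path_edges_rev[of "q1 @ [z]"] by simp
      moreover have "path_edges (p1 @ z # rev q1) = path_edges (p1 @ [z]) \<union> path_edges (z # rev q1)"
        by (cases "p1 = []") (auto simp: path_edges_append)
      moreover have "path_edges ?c = insert {u, hd p} (path_edges (p1 @ z # rev q1))"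
        unfolding p by (subst path_edges_Cons) (auto simp: hd_append)
      ultimately have "path_edges ?c \<subseteq> edges G" using pe(1) e(1) by auto
      moreover have "distinct ?c" "set ?c \<subseteq> verts G"
        using p' q' u p1 unfolding p q1 simple_path_iff by auto
      ultimately have "simple_path G u ?c (hd q')"
        unfolding simple_path_iff q1 by (cases q1) auto
      \<comment> \<open>\<open>p1\<close> and \<open>q1\<close> are not both empty, since otherwise
        both \<open>hd p\<close> and \<open>hd q'\<close> would be \<open>z\<close>.\<close>
      moreover have "3 \<le> length ?c"
        using neq unfolding p q1 by (cases p1; cases q1) auto
      ultimately show ?thesis
        using assms e(2) unfolding acyclic_graph_def by (metis insert_commute)
    qed
  qed
qed

section \<open>Membership of an edge in tree paths, tested from a root\<close>

definition tree_path :: "'a ugraph \<Rightarrow> 'a \<Rightarrow> 'a \<Rightarrow> 'a list" where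
  "tree_path G u v = (THE p. simple_path G u p v)"

lemma tree_path_eqI:
  "finite_tree G \<Longrightarrow> simple_path G u p v \<Longrightarrow> tree_path G u v = p"
  unfolding tree_path_def finite_tree_def using acyclic_simple_path_unique by (metis the_equality)

lemma simple_path_tree_path:
  "finite_tree G \<Longrightarrow> u \<in> verts G \<Longrightarrow> v \<in> verts G \<Longrightarrow> simple_path G u (tree_path G u v) v"
  using tree_path_eqI unfolding finite_tree_def connected_graph_def by (metis finite_tree_def)

text \<open>Moving across one edge changes the root path by that edge alone: if \<open>v\<close> is
  not yet on the path to \<open>u\<close>, the edge is appended; otherwise \<open>v\<close> is the
  vertex just before \<open>u\<close>, and the edge is removed from the end.\<close>

lemma tree_path_adjacent:
  assumes G: "finite_tree G" and r: "r \<in> verts G" and u: "u \<in> verts G" and v: "v \<in> verts G"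
    and neq: "u \<noteq> v" and uv: "{u, v} \<in> edges G"
  shows "e \<in> path_edges (tree_path G r v) \<longleftrightarrow>
    (e \<in> path_edges (tree_path G r u)) \<noteq> (e = {u, v})"
proof -
  let ?p = "tree_path G r u"
  have p: "simple_path G r ?p u" by (rule simple_path_tree_path[OF G r u])
  show ?thesis
  proof (cases "v \<in> set ?p")
    case False
    have "simple_path G r (?p @ [v]) v"
      using p False v uv unfolding simple_path_iff by (auto simp: path_edges_append)
    from tree_path_eqI[OF G this] have "path_edges (tree_path G r v) = insert {u, v} (path_edges ?p)"
      using p by (simp add: simple_path_iff path_edges_append)
    moreover have "{u, v} \<notin> path_edges ?p"
      using False path_edges_subset_set[of "{u, v}" ?p] by auto
    ultimately show ?thesis by auto
  next
    case True
    then obtain q q' where q: "?p = q @ v # q'" by (meson split_list)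
    have q': "q' \<noteq> []" using p neq unfolding q simple_path_iff by auto
    have "path_edges ?p = path_edges (q @ [v]) \<union> path_edges (v # q')"
      unfolding q by (cases "q = []") (auto simp: path_edges_append)
    then have path: "simple_path G v (v # q') u" "simple_path G r (q @ [v]) v"
      using p q' unfolding q simple_path_iff by (auto simp: hd_append)
    \<comment> \<open>A longer segment from \<open>v\<close> to \<open>u\<close> would form a cycle
      with the edge \<open>{u, v}\<close>.\<close>
    have "\<not> 3 \<le> length (v # q')"
      using G path(1) uv unfolding finite_tree_def acyclic_graph_def by blast
    with q' have "length q' = Suc 0"
      unfolding length_greater_0_conv[symmetric] list.size by linarith
    then obtain x where "q' = [x]" by (auto simp: length_Suc_conv)
    with path(1) have "q' = [u]" by (simp add: simple_path_iff)
    then have eq: "?p = (q @ [v]) @ [u]" using q by simp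
    have "u \<notin> set (q @ [v])" using p unfolding eq simple_path_iff by auto
    then have "{u, v} \<notin> path_edges (q @ [v])"
      using path_edges_subset_set[of "{u, v}" "q @ [v]"] by auto
    moreover have "path_edges ?p = insert {u, v} (path_edges (q @ [v]))"
      using path_edges_append[of "q @ [v]" "[u]"] unfolding eq by (simp add: insert_commute)
    ultimately show ?thesis
      unfolding tree_path_eqI[OF G path(2)] by blast
  qed
qed

text \<open>The edge set of a path is the symmetric difference of the root paths to its ends: each
  step toggles its own edge, and a simple path repeats no edge. Hence an edge lies on the path
  exactly when it separates the two ends.\<close>

lemma mem_path_edges_iff_root:
  assumes G: "finite_tree G" and r: "r \<in> verts G"
  shows "simple_path G u p v \<Longrightarrow> e \<in> path_edges p \<longleftrightarrow>
    (e \<in> path_edges (tree_path G r u)) \<noteq> (e \<in> path_edges (tree_path G r v))"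
proof (induction p arbitrary: u)
  case Nil
  then show ?case by (simp add: simple_path_iff)
next
  case (Cons x p)
  show ?case
  proof (cases p)
    case Nil
    then show ?thesis using Cons.prems by (auto simp: simple_path_iff)
  next
    case (Cons y p')
    have sp: "simple_path G y p v" and xu: "x = u" and V: "u \<in> verts G" "y \<in> verts G"
      and neq: "u \<noteq> y" and uy: "{u, y} \<in> edges G" and u: "u \<notin> set p"
      using Cons.prems unfolding Cons simple_path_iff by auto
    have "{u, y} \<notin> path_edges p" using u path_edges_subset_set[of "{u, y}" p] by auto
    moreover have "path_edges (x # p) = insert {u, y} (path_edges p)" using Cons xu by simp
    moreover note Cons.IH[OF sp] tree_path_adjacent[OF G r V neq uy, of e]
    ultimately show ?thesis by (cases "e = {u, y}") simp_all
  qed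
qed

section \<open>The quadratic form of the distance as a sum over edge cuts\<close>

lemma tree_dist_eq:
  "finite_tree G \<Longrightarrow> simple_path G u p v \<Longrightarrow> tree_dist G \<alpha> u v = sum \<alpha> (path_edges p)"
  using tree_path_eqI unfolding tree_dist_def tree_path_def by metis

lemma finite_edges: "finite_tree G \<Longrightarrow> finite (edges G)"
  by (rule finite_subset[of _ "Pow (verts G)"]) (auto simp: finite_tree_def simple_graph_def)

text \<open>For an edge \<open>e\<close>, the path from \<open>r\<close> to \<open>u\<close> uses
  \<open>e\<close> exactly when deleting \<open>e\<close> separates \<open>u\<close> from
  \<open>r\<close>. This is thus the weight \<open>X\<^sub>e\<close> of the side away from the
  root.\<close>

definition branch_weight :: "'a ugraph \<Rightarrow> 'a \<Rightarrow> 'a set \<Rightarrow> ('a \<Rightarrow> real) \<Rightarrow> 'a set \<Rightarrow> real" where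
  "branch_weight G r S c e = (\<Sum>u\<in>S. c u * of_bool (e \<in> path_edges (tree_path G r u)))"

text \<open>An edge contributes its length to precisely those ordered pairs that it separates. Their
  total weight is twice the product of the weights of the two sides.\<close>

lemma tree_dist_quadratic_form:
  assumes G: "finite_tree G" and r: "r \<in> verts G" and S: "S \<subseteq> verts G"
  shows "(\<Sum>u\<in>S. \<Sum>v\<in>S. c u * c v * tree_dist G \<alpha> u v) =
    (\<Sum>e\<in>edges G. \<alpha> e * (2 * branch_weight G r S c e * (sum c S - branch_weight G r S c e)))"
proof -
  define a where "a e u = (of_bool (e \<in> path_edges (tree_path G r u)) :: real)" for e u
  \<comment> \<open>For indicators \<open>a\<close> and \<open>b\<close>, the expression
    \<open>a * (1 - b) + b * (1 - a)\<close> is their exclusive or, so it tests separation by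
    \<open>e\<close>.\<close>
  have d: "tree_dist G \<alpha> u v = (\<Sum>e\<in>edges G. \<alpha> e * (a e u * (1 - a e v) + a e v * (1 - a e u)))"
    if "u \<in> S" "v \<in> S" for u v
  proof -
    have p: "simple_path G u (tree_path G u v) v"
      using simple_path_tree_path[OF G] that S by auto
    have "tree_dist G \<alpha> u v = (\<Sum>e\<in>edges G. \<alpha> e * of_bool (e \<in> path_edges (tree_path G u v)))"
      unfolding tree_dist_eq[OF G p]
      using p finite_edges[OF G] by (intro sum.mono_neutral_cong_left) (auto simp: simple_path_iff)
    then show ?thesis
      by (auto simp: a_def mem_path_edges_iff_root[OF G r p] intro!: sum.cong)
  qed
  have X: "branch_weight G r S c e = (\<Sum>u\<in>S. c u * a e u)" for e
    by (simp add: branch_weight_def a_def)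
  have Y: "sum c S - branch_weight G r S c e = (\<Sum>u\<in>S. c u * (1 - a e u))" for e
    unfolding X by (simp add: algebra_simps sum_subtractf)
  have "(\<Sum>u\<in>S. \<Sum>v\<in>S. c u * c v * tree_dist G \<alpha> u v) =
      (\<Sum>u\<in>S. \<Sum>v\<in>S. \<Sum>e\<in>edges G. \<alpha> e * ((c u * a e u) * (c v * (1 - a e v))
         + (c u * (1 - a e u)) * (c v * a e v)))"
    by (intro sum.cong) (auto simp: d sum_distrib_left algebra_simps intro!: sum.cong)
  also have "\<dots> = (\<Sum>e\<in>edges G. \<Sum>u\<in>S. \<Sum>v\<in>S. \<alpha> e * ((c u * a e u) * (c v * (1 - a e v))
         + (c u * (1 - a e u)) * (c v * a e v)))"
    by (subst sum.swap[of _ "edges G"], intro sum.cong refl sum.swap)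
  also have "\<dots> = (\<Sum>e\<in>edges G. \<alpha> e *
      (branch_weight G r S c e * (sum c S - branch_weight G r S c e) +
       (sum c S - branch_weight G r S c e) * branch_weight G r S c e))"
  proof (intro sum.cong refl)
    fix e
    have XY: "branch_weight G r S c e * (sum c S - branch_weight G r S c e) =
        (\<Sum>u\<in>S. \<Sum>v\<in>S. (c u * a e u) * (c v * (1 - a e v)))"
      "(sum c S - branch_weight G r S c e) * branch_weight G r S c e =
        (\<Sum>u\<in>S. \<Sum>v\<in>S. (c u * (1 - a e u)) * (c v * a e v))"
      unfolding Y unfolding X by (rule sum_product)+
    show "(\<Sum>u\<in>S. \<Sum>v\<in>S. \<alpha> e * ((c u * a e u) * (c v * (1 - a e v))
          + (c u * (1 - a e u)) * (c v * a e v))) =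
        \<alpha> e * (branch_weight G r S c e * (sum c S - branch_weight G r S c e) +
          (sum c S - branch_weight G r S c e) * branch_weight G r S c e)"
      unfolding XY sum.distrib[symmetric] sum_distrib_left ..
  qed
  finally show ?thesis by (simp add: algebra_simps)
qed

lemma mult_compl_le_quarter: "x * (1 - x) \<le> (1 / 4 :: real)"
proof -
  have "0 \<le> (x - 1/2)^2" by simp
  then show ?thesis by (simp add: power2_eq_square algebra_simps)
qed

lemma tree_dist_quadratic_form_le:
  assumes G: "finite_tree G" and \<alpha>: "\<forall>e\<in>edges G. 0 < \<alpha> e"
    and S: "S \<subseteq> verts G" and c: "sum c S = 1"
  shows "(\<Sum>u\<in>S. \<Sum>v\<in>S. c u * c v * tree_dist G \<alpha> u v) \<le> 1 / 2 * sum \<alpha> (edges (conv_hull S G))"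
proof -
  \<comment> \<open>With the root in \<open>S\<close>, all root paths to points of \<open>S\<close>
    stay in the convex hull, so edges outside it have branch weight 0.\<close>
  obtain r where r: "r \<in> S" using c by (cases "S = {}") auto
  then have rV: "r \<in> verts G" using S by auto
  let ?X = "branch_weight G r S c"
  have zero: "?X e = 0" if e: "e \<notin> edges (conv_hull S G)" for e
    unfolding branch_weight_def
  proof (rule sum.neutral, intro ballI)
    fix u assume "u \<in> S"
    then have "simple_path G r (tree_path G r u) u"
      using simple_path_tree_path[OF G rV] S by auto
    then show "c u * of_bool (e \<in> path_edges (tree_path G r u)) = 0"
      using e r \<open>u \<in> S\<close> unfolding conv_hull_def by auto
  qed
  have sub: "edges (conv_hull S G) \<subseteq> edges G"
    by (auto simp: conv_hull_def simple_path_iff)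
  have "(\<Sum>u\<in>S. \<Sum>v\<in>S. c u * c v * tree_dist G \<alpha> u v) =
      (\<Sum>e\<in>edges G. \<alpha> e * (2 * ?X e * (1 - ?X e)))"
    using tree_dist_quadratic_form[OF G rV S] c by simp
  also have "\<dots> = (\<Sum>e\<in>edges (conv_hull S G). \<alpha> e * (2 * ?X e * (1 - ?X e)))"
    using sub finite_edges[OF G] zero by (intro sum.mono_neutral_right) auto
  also have "\<dots> \<le> (\<Sum>e\<in>edges (conv_hull S G). \<alpha> e * (1 / 2))"
  proof (intro sum_mono mult_left_mono)
    fix e assume "e \<in> edges (conv_hull S G)"
    then show "0 \<le> \<alpha> e" using \<alpha> sub by (auto intro: less_imp_le)
    show "2 * ?X e * (1 - ?X e) \<le> 1 / 2"
      using mult_compl_le_quarter[of "?X e"] by simp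
  qed
  finally show ?thesis by (simp add: sum_distrib_left mult.commute)
qed

text \<open>Rooting the tree at \<open>u\<close>, every other vertex lies behind exactly one edge at \<open>u\<close>, so
  the branch weights at those edges add up to the weight outside \<open>u\<close>.\<close>

lemma sum_branch_weight_incident:
  assumes G: "finite_tree G" and S: "S \<subseteq> verts G" and u: "u \<in> S"
  shows "(\<Sum>e\<in>{e \<in> edges G. u \<in> e}. branch_weight G u S c e) = sum c S - c u"
proof -
  have fin: "finite S" using S G by (auto simp: finite_tree_def intro: finite_subset)
  have uV: "u \<in> verts G" using u S by auto
  have one: "(\<Sum>e\<in>{e \<in> edges G. u \<in> e}. of_bool (e \<in> path_edges (tree_path G u v))) =
      (of_bool (v \<noteq> u) :: real)" if v: "v \<in> S" for v
  proof -
    let ?p = "tree_path G u v"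
    have p: "simple_path G u ?p v" using simple_path_tree_path[OF G uV] v S by auto
    \<comment> \<open>A simple path starting at \<open>u\<close> meets \<open>u\<close> only in its
      first edge, whose other end is \<open>hd (tl ?p)\<close>.\<close>
    have "{e \<in> edges G. u \<in> e} \<inter> {e. e \<in> path_edges ?p} =
        (if v = u then {} else {{u, hd (tl ?p)}})"
    proof (cases ?p)
      case Nil
      then show ?thesis using p by (simp add: simple_path_iff)
    next
      case (Cons x p')
      show ?thesis
      proof (cases p')
        case Nil
        then show ?thesis using p Cons by (auto simp: simple_path_iff)
      next
        case (Cons y p'')
        have "\<And>e. e \<in> path_edges p' \<Longrightarrow> u \<notin> e"
          using p path_edges_subset_set[of _ p'] \<open>?p = x # p'\<close> by (auto simp: simple_path_iff)
        moreover have "v \<noteq> u" using p \<open>?p = x # p'\<close> Cons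
          by (auto simp: simple_path_iff split: if_splits)
        ultimately show ?thesis using p Cons \<open>?p = x # p'\<close> by (auto simp: simple_path_iff)
      qed
    qed
    then show ?thesis using finite_edges[OF G] by simp
  qed
  have "(\<Sum>e\<in>{e \<in> edges G. u \<in> e}. branch_weight G u S c e) = (\<Sum>v\<in>S. c v * of_bool (v \<noteq> u))"
    unfolding branch_weight_def
    by (subst sum.swap) (simp add: sum_distrib_left[symmetric] one)
  also have "\<dots> = sum c (S - {u})"
    using fin by (intro sum.mono_neutral_cong_right) auto
  finally show ?thesis using fin u by (simp add: sum_diff1)
qed

section \<open>Strict conditional negative definiteness of the tree distance\<close>

definition cond_neg_def :: "'a set \<Rightarrow> ('a \<Rightarrow> 'a \<Rightarrow> real) \<Rightarrow> bool" where
  "cond_neg_def S d \<longleftrightarrow>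
    (\<forall>c. sum c S = 0 \<longrightarrow> (\<exists>u\<in>S. c u \<noteq> 0) \<longrightarrow> (\<Sum>u\<in>S. \<Sum>v\<in>S. c u * c v * d u v) < 0)"

text \<open>With total weight 0 the cut formula becomes minus a sum of terms
  \<open>2 * \<alpha> e * X\<^sub>e * X\<^sub>e\<close>. Rooting at a vertex \<open>u\<close> with
  \<open>c u\<close> nonzero, the branch weights at the edges of \<open>u\<close> add up to
  \<open>- c u\<close>, so some term is nonzero.\<close>

lemma cond_neg_def_tree_dist:
  assumes G: "finite_tree G" and \<alpha>: "\<forall>e\<in>edges G. 0 < \<alpha> e" and S: "S \<subseteq> verts G"
  shows "cond_neg_def S (tree_dist G \<alpha>)"
  unfolding cond_neg_def_def
proof (intro allI impI, elim bexE)
  fix c :: "'a \<Rightarrow> real" and u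
  assume c: "sum c S = 0" and u: "u \<in> S" "c u \<noteq> 0"
  let ?X = "branch_weight G u S c"
  have "\<exists>e\<in>edges G. ?X e \<noteq> 0"
  proof (rule ccontr)
    assume "\<not> ?thesis"
    then have "(\<Sum>e\<in>{e \<in> edges G. u \<in> e}. ?X e) = 0" by (intro sum.neutral) auto
    then show False using sum_branch_weight_incident[OF G S u(1), of c] c u(2) by simp
  qed
  then obtain e where e: "e \<in> edges G" "?X e \<noteq> 0" by auto
  have "0 < (\<Sum>e\<in>edges G. \<alpha> e * (2 * ?X e * ?X e))"
  proof (rule sum_pos2[OF finite_edges[OF G] e(1)])
    show "0 < \<alpha> e * (2 * ?X e * ?X e)"
      using e \<alpha> not_real_square_gt_zero[of "?X e"] by (simp add: mult.assoc zero_less_mult_iff)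
  next
    fix f assume "f \<in> edges G"
    then show "0 \<le> \<alpha> f * (2 * ?X f * ?X f)"
      using \<alpha> by (simp add: mult.assoc less_imp_le)
  qed
  moreover have "u \<in> verts G" using u S by auto
  ultimately show "(\<Sum>u\<in>S. \<Sum>v\<in>S. c u * c v * tree_dist G \<alpha> u v) < 0"
    using tree_dist_quadratic_form[OF G _ S, of u c \<alpha>] c by (simp add: sum_negf)
qed

section \<open>Linear algebra of the ratio of determinant to cofactor sum\<close>

lemma singular_indexed_matrix:
  fixes f :: "'a \<Rightarrow> 'a \<Rightarrow> real"
  assumes b: "bij_betw b {..<k} S" and 0: "det (mat k k (\<lambda>(i, j). f (b i) (b j))) = 0"
  obtains c where "\<exists>u\<in>S. c u \<noteq> 0" "\<forall>u\<in>S. (\<Sum>v\<in>S. f u v * c v) = 0"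
proof -
  let ?A = "mat k k (\<lambda>(i, j). f (b i) (b j))"
  obtain x where x: "x \<in> carrier_vec k" "x \<noteq> 0\<^sub>v k" "?A *\<^sub>v x = 0\<^sub>v k"
    using det_0_iff_vec_prod_zero[of ?A k] 0 by auto
  \<comment> \<open>The kernel vector is read as a function on \<open>S\<close>, so that later
    arguments are free of the enumeration \<open>b\<close>.\<close>
  define c where "c v = x $ the_inv_into {..<k} b v" for v
  have inj: "inj_on b {..<k}" using b by (simp add: bij_betw_def)
  have cb: "c (b i) = x $ i" if "i < k" for i
    using the_inv_into_f_f[OF inj, of i] that by (simp add: c_def)
  show ?thesis
  proof (rule that)
    from x(1,2) obtain i where "i < k" "x $ i \<noteq> 0" by fastforce
    then show "\<exists>u\<in>S. c u \<noteq> 0" using b cb by (auto simp: bij_betw_def)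
    show "\<forall>u\<in>S. (\<Sum>v\<in>S. f u v * c v) = 0"
    proof
      fix u assume "u \<in> S"
      then obtain i where i: "i < k" "u = b i" using b by (auto simp: bij_betw_def)
      have "(\<Sum>v\<in>S. f u v * c v) = (\<Sum>j<k. f u (b j) * x $ j)"
        by (simp add: sum.reindex_bij_betw[OF b, symmetric] cb)
      also have "\<dots> = (?A *\<^sub>v x) $ i"
        using i x(1) by (auto simp: scalar_prod_def lessThan_atLeast0 intro!: sum.cong)
      finally show "(\<Sum>v\<in>S. f u v * c v) = 0" using x(3) i by simp
    qed
  qed
qed

text \<open>When the potential of \<open>c\<close> is constant, the form at \<open>c\<close> is
  \<open>sum c S * t\<close>, which is 0; strict negativity then leaves only \<open>c = 0\<close> on
  \<open>S\<close>.\<close>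

lemma cond_neg_def_eq_0:
  assumes "cond_neg_def S d" "sum c S = 0" "\<forall>u\<in>S. (\<Sum>v\<in>S. d u v * c v) = t"
  shows "\<forall>u\<in>S. c u = 0"
proof (rule ccontr)
  assume "\<not> ?thesis"
  then have "(\<Sum>u\<in>S. \<Sum>v\<in>S. c u * c v * d u v) < 0"
    using assms unfolding cond_neg_def_def by blast
  moreover have "(\<Sum>u\<in>S. \<Sum>v\<in>S. c u * c v * d u v) = (\<Sum>u\<in>S. c u * (\<Sum>v\<in>S. d u v * c v))"
    by (simp add: sum_distrib_left mult_ac)
  also have "\<dots> = sum c S * t" using assms(3) by (simp add: sum_distrib_right)
  ultimately show False using assms(2) by simp
qed

text \<open>The witness is the adjugate of \<open>A\<close> applied to the all-ones vector, divided by \<open>cof A\<close>;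
  the negativity assumption forces \<open>cof A \<noteq> 0\<close>.\<close>

lemma det_div_cof_equilibrium:
  fixes d :: "'a \<Rightarrow> 'a \<Rightarrow> real" and b :: "nat \<Rightarrow> 'a" and k :: nat
  defines "A \<equiv> mat k k (\<lambda>(i, j). d (b i) (b j))"
  assumes b: "bij_betw b {..<k} S" and S: "S \<noteq> {}"
    and sym: "\<And>u v. u \<in> S \<Longrightarrow> v \<in> S \<Longrightarrow> d u v = d v u" and neg: "cond_neg_def S d"
  obtains w where "sum w S = 1" "\<forall>u\<in>S. (\<Sum>v\<in>S. d u v * w v) = det A / cof A"
proof -
  have A: "A \<in> carrier_mat k k" by (simp add: A_def)
  have fin: "finite S" using b bij_betw_finite by blast
  have inj: "inj_on b {..<k}" using b by (simp add: bij_betw_def)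
  define W where "W v = (\<Sum>j<k. cofactor A j (the_inv_into {..<k} b v))" for v
  have Wb: "W (b i) = (\<Sum>j<k. cofactor A j i)" if "i < k" for i
    using the_inv_into_f_f[OF inj, of i] that by (simp add: W_def)
  \<comment> \<open>These are the row sums of \<open>A * adj_mat A\<close>, which is
    \<open>det A\<close> times the identity.\<close>
  have AW: "(\<Sum>v\<in>S. d u v * W v) = det A" if u: "u \<in> S" for u
  proof -
    from u obtain i where i: "i < k" "u = b i" using b by (auto simp: bij_betw_def)
    have "(\<Sum>v\<in>S. d u v * W v) = (\<Sum>l<k. \<Sum>j<k. A $$ (i, l) * cofactor A j l)"
      using i by (simp add: sum.reindex_bij_betw[OF b, symmetric] Wb A_def sum_distrib_left)
    also have "\<dots> = (\<Sum>j<k. \<Sum>l<k. A $$ (i, l) * cofactor A j l)" by (rule sum.swap)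
    also have "\<dots> = (\<Sum>j<k. (A * adj_mat A) $$ (i, j))"
      using i A by (intro sum.cong)
        (auto simp: adj_mat_def scalar_prod_def lessThan_atLeast0 intro!: sum.cong)
    also have "\<dots> = (\<Sum>j<k. if j = i then det A else 0)"
      using i by (intro sum.cong) (auto simp: adj_mat(2)[OF A])
    also have "\<dots> = det A" using i by simp
    finally show ?thesis .
  qed
  have sumW: "sum W S = cof A"
  proof -
    have "sum W S = (\<Sum>i<k. \<Sum>j<k. cofactor A j i)"
      by (simp add: sum.reindex_bij_betw[OF b, symmetric] Wb)
    then show ?thesis using A by (subst (asm) sum.swap) (simp add: cof_def)
  qed
  have "cof A \<noteq> 0"
  proof
    assume cof0: "cof A = 0"
    \<comment> \<open>\<open>W\<close> has constant potential \<open>det A\<close> and, by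
      assumption, total 0, so it vanishes. Then \<open>det A = 0\<close>, and a kernel vector
      \<open>c\<close> exists; the aim is a second kernel vector that is not proportional to
      \<open>c\<close>.\<close>
    have W0: "\<forall>u\<in>S. W u = 0"
      using cond_neg_def_eq_0[OF neg, of W "det A"] AW sumW cof0 by simp
    have "det A = 0" using AW S W0 by fastforce
    then obtain c where c: "\<exists>u\<in>S. c u \<noteq> 0" "\<forall>u\<in>S. (\<Sum>v\<in>S. d u v * c v) = 0"
      using singular_indexed_matrix[OF b, of d] unfolding A_def by blast
    have sumc: "sum c S \<noteq> 0" using cond_neg_def_eq_0[OF neg _ c(2)] c(1) by blast
    from c(1) obtain i where i: "i < k" "c (b i) \<noteq> 0" using b by (auto simp: bij_betw_def)
    define s where "s = b i"
    have s: "s \<in> S" using b i by (auto simp: s_def bij_betw_def)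
    \<comment> \<open>By Cramer's rule, \<open>W s\<close> is the determinant after replacing column \<open>s\<close> by ones.\<close>
    define f where "f u v = (if v = s then 1 else d u v)" for u v
    let ?B = "mat k k (\<lambda>(i, j). f (b i) (b j))"
    have "det ?B = (\<Sum>j<k. ?B $$ (j, i) * cofactor ?B j i)"
      using i by (intro laplace_expansion_column) auto
    also have "\<dots> = (\<Sum>j<k. cofactor A j i)"
    proof (intro sum.cong refl)
      fix j assume "j \<in> {..<k}"
      then have j: "j < k" by simp
      \<comment> \<open>By injectivity of \<open>b\<close> only column \<open>i\<close> was
        replaced, and the minors in the expansion delete that column.\<close>
      have "b l \<noteq> s" if "l < k" "l \<noteq> i" for l
        using inj_onD[OF inj, of l i] that i by (auto simp: s_def)
      then have "mat_delete ?B j i = mat_delete A j i"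
        unfolding mat_delete_def A_def f_def by (intro eq_matI) auto
      then show "?B $$ (j, i) * cofactor ?B j i = cofactor A j i"
        using i j by (simp add: cofactor_def f_def s_def)
    qed
    also have "\<dots> = 0" using W0 Wb i s s_def by metis
    finally obtain g where g: "\<exists>u\<in>S. g u \<noteq> 0" "\<forall>u\<in>S. (\<Sum>v\<in>S. f u v * g v) = 0"
      using singular_indexed_matrix[OF b, of f] by blast
    have fg: "(\<Sum>v\<in>S. f u v * g v) = g s + (\<Sum>v\<in>S - {s}. d u v * g v)" for u
      unfolding sum.remove[OF fin s] by (simp add: f_def)
    \<comment> \<open>Pairing the kernel equation of \<open>?B\<close> with \<open>c\<close>
      annihilates every column but \<open>s\<close>, because \<open>d\<close> is symmetric and
      \<open>c\<close> is in its kernel. What remains is \<open>sum c S * g s\<close>, so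
      \<open>g s = 0\<close> and \<open>g\<close> is itself in the kernel of
      \<open>d\<close>.\<close>
    have "0 = (\<Sum>u\<in>S. c u * (\<Sum>v\<in>S. f u v * g v))" using g(2) by simp
    also have "\<dots> = sum c S * g s + (\<Sum>u\<in>S. \<Sum>v\<in>S - {s}. c u * (d u v * g v))"
      by (simp add: fg distrib_left sum.distrib sum_distrib_left sum_distrib_right)
    also have "(\<Sum>u\<in>S. \<Sum>v\<in>S - {s}. c u * (d u v * g v)) =
        (\<Sum>v\<in>S - {s}. g v * (\<Sum>u\<in>S. d v u * c u))"
      by (subst sum.swap) (auto simp: sum_distrib_left sym mult_ac intro!: sum.cong)
    also have "\<dots> = 0" using c(2) by (intro sum.neutral) auto
    finally have gs: "g s = 0" using sumc by simp
    have dg: "(\<Sum>v\<in>S. d u v * g v) = 0" if "u \<in> S" for u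
      using g(2) fg[of u] that gs by (simp add: sum.remove[OF fin s])
    have sumg: "sum g S \<noteq> 0" using cond_neg_def_eq_0[OF neg, of g] dg g(1) by blast
    \<comment> \<open>This combination of the two kernel vectors has total 0 and must vanish. At
      \<open>s\<close>, however, it equals \<open>sum g S * c s\<close>, a product of nonzero
      factors.\<close>
    define h where "h v = sum g S * c v - sum c S * g v" for v
    have "sum h S = 0" by (simp add: h_def sum_subtractf sum_distrib_left[symmetric])
    moreover have "(\<Sum>v\<in>S. d u v * h v) = 0" if "u \<in> S" for u
    proof -
      have "(\<Sum>v\<in>S. d u v * h v) =
          sum g S * (\<Sum>v\<in>S. d u v * c v) - sum c S * (\<Sum>v\<in>S. d u v * g v)"
        unfolding h_def right_diff_distrib sum_subtractf sum_distrib_left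
        by (simp add: mult_ac)
      then show ?thesis using c(2) dg that by simp
    qed
    ultimately have "h s = 0" using cond_neg_def_eq_0[OF neg, of h] s by blast
    then show False using gs sumg i by (simp add: h_def s_def)
  qed
  then show ?thesis
    using AW sumW
    by (intro that[of "\<lambda>v. W v / cof A"])
      (simp_all add: sum_divide_distrib[symmetric])
qed

text \<open>Write \<open>c = w + h\<close> with \<open>sum h S = 0\<close>. As \<open>w\<close> has
  constant potential \<open>t\<close>, the mixed terms collapse and the form at \<open>c\<close> is
  \<open>t\<close> plus the form at \<open>h\<close>, which is at most 0.\<close>

lemma quadratic_form_le_equilibrium:
  fixes d :: "'a \<Rightarrow> 'a \<Rightarrow> real"
  assumes neg: "cond_neg_def S d" and sym: "\<And>u v. u \<in> S \<Longrightarrow> v \<in> S \<Longrightarrow> d u v = d v u"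
    and w: "sum w S = 1" "\<forall>u\<in>S. (\<Sum>v\<in>S. d u v * w v) = t" and c: "sum c S = 1"
  shows "(\<Sum>u\<in>S. \<Sum>v\<in>S. c u * c v * d u v) \<le> t"
proof -
  define h where "h u = c u - w u" for u
  have Q: "(\<Sum>u\<in>S. \<Sum>v\<in>S. x u * w v * d u v) = sum x S * t" for x
  proof -
    have "(\<Sum>u\<in>S. \<Sum>v\<in>S. x u * w v * d u v) = (\<Sum>u\<in>S. x u * (\<Sum>v\<in>S. d u v * w v))"
      by (simp add: sum_distrib_left mult_ac)
    then show ?thesis using w(2) by (simp add: sum_distrib_right)
  qed
  have Q': "(\<Sum>u\<in>S. \<Sum>v\<in>S. w u * x v * d u v) = sum x S * t" for x
    by (subst sum.swap, subst Q[symmetric]) (auto simp: sym mult_ac intro!: sum.cong)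
  have h0: "sum h S = 0" by (simp add: h_def sum_subtractf c w(1))
  have "(\<Sum>u\<in>S. \<Sum>v\<in>S. h u * h v * d u v) \<le> 0"
  proof (cases "\<exists>u\<in>S. h u \<noteq> 0")
    case True
    then show ?thesis using neg h0 unfolding cond_neg_def_def by (auto intro: less_imp_le)
  qed simp
  moreover have "(\<Sum>u\<in>S. \<Sum>v\<in>S. c u * c v * d u v) =
      (\<Sum>u\<in>S. \<Sum>v\<in>S. h u * h v * d u v) + (\<Sum>u\<in>S. \<Sum>v\<in>S. h u * w v * d u v)
      + (\<Sum>u\<in>S. \<Sum>v\<in>S. w u * c v * d u v)"
    unfolding sum.distrib[symmetric] by (intro sum.cong refl) (simp add: h_def algebra_simps)
  ultimately show ?thesis using Q[of h] Q'[of c] h0 c by simp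
qed

section \<open>Passage to principal submatrices and proof of the two bounds\<close>

lemma principal_submatrix_distance_matrix:
  fixes G :: "'a ugraph"
  assumes vs: "distinct vs" and S: "S \<subseteq> set vs"
  obtains b k where "bij_betw b {..<k} S"
    "principal_submatrix (distance_matrix G \<alpha> vs) vs S =
      mat k k (\<lambda>(i, j). tree_dist G \<alpha> (b i) (b j))"
proof -
  define I where "I = {i. i < length vs \<and> vs ! i \<in> S}"
  have I: "{i. i < length vs \<and> i \<in> I} = I" "finite I" by (auto simp: I_def)
  have pI: "pick I i \<in> I" if "i < card I" for i using pick_in_set_le that by blast
  \<comment> \<open>\<open>pick I\<close> lists \<open>I\<close> in increasing order, hence without
    repetition.\<close>
  have "inj_on (pick I) {..<card I}"
  proof (rule inj_onI)
    fix i j assume "i \<in> {..<card I}" "j \<in> {..<card I}" "pick I i = pick I j"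
    then show "i = j" using pick_mono_le[of i I j] pick_mono_le[of j I i]
      by (cases i j rule: linorder_cases) auto
  qed
  moreover have "pick I ` {..<card I} = I"
    using pI calculation I(2)
    by (intro card_subset_eq) (auto simp: card_image)
  ultimately have bij: "bij_betw (pick I) {..<card I} I" by (simp add: bij_betw_def)
  have "bij_betw ((!) vs) I S"
    using vs S by (auto simp: I_def bij_betw_def inj_on_def nth_eq_iff_index_eq in_set_conv_nth subset_iff)
  from bij_betw_trans[OF bij this] have b: "bij_betw ((!) vs \<circ> pick I) {..<card I} S" .
  have "pick I i < length vs" if "i < card I" for i using pI[OF that] by (simp add: I_def)
  then have "submatrix (distance_matrix G \<alpha> vs) I I =
      mat (card I) (card I) (\<lambda>(i, j). tree_dist G \<alpha> (((!) vs \<circ> pick I) i) (((!) vs \<circ> pick I) j))"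
    unfolding submatrix_def by (auto simp: distance_matrix_def I(1))
  then show ?thesis using that b
    unfolding principal_submatrix_def Let_def I_def[symmetric] by blast
qed

lemma tree_dist_commute:
  assumes "finite_tree G" "u \<in> verts G" "v \<in> verts G"
  shows "tree_dist G \<alpha> u v = tree_dist G \<alpha> v u"
proof -
  have p: "simple_path G u (tree_path G u v) v" by (rule simple_path_tree_path[OF assms])
  then have "simple_path G v (rev (tree_path G u v)) u"
    by (auto simp: simple_path_iff path_edges_rev hd_rev last_rev)
  then show ?thesis
    using tree_dist_eq[OF assms(1)] p path_edges_rev by metis
qed

lemma tree_dist_self: "finite_tree G \<Longrightarrow> u \<in> verts G \<Longrightarrow> tree_dist G \<alpha> u u = 0"
  using tree_dist_eq[of G u "[u]" u \<alpha>] by (simp add: simple_path_iff)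

theorem theoremD:
  fixes G :: "'a ugraph" and \<alpha> :: "'a set \<Rightarrow> real" and vs :: "'a list"
  assumes "finite_tree G"
    and "\<forall>e\<in>edges G. 0 < \<alpha> e"
    and "distinct vs" and "set vs = verts G"
  defines "D \<equiv> distance_matrix G \<alpha> vs"
  shows "(\<forall>S. S \<noteq> {} \<and> S \<subseteq> verts G \<longrightarrow>
            det (principal_submatrix D vs S) / cof (principal_submatrix D vs S)
              \<le> 1 / 2 * (\<Sum>e\<in>edges (conv_hull S G). \<alpha> e)) \<and>
         (\<forall>S s0 s1 \<gamma>. S \<subseteq> verts G \<and> s0 \<in> S \<and> s1 \<in> S \<and> simple_path G s0 \<gamma> s1 \<longrightarrow>
            1 / 2 * (\<Sum>e\<in>path_edges \<gamma>. \<alpha> e)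
              \<le> det (principal_submatrix D vs S) / cof (principal_submatrix D vs S))"
proof -
  note G = assms(1) and \<alpha> = assms(2)
  let ?t = "\<lambda>S. det (principal_submatrix D vs S) / cof (principal_submatrix D vs S)"
  let ?Q = "\<lambda>S c. \<Sum>u\<in>S. \<Sum>v\<in>S. c u * c v * tree_dist G \<alpha> u v"
  \<comment> \<open>An upper bound on the form at the maximizer yields (a); any test vector of total
    1 yields a lower bound as in (b).\<close>
  have attained: "\<exists>w. sum w S = 1 \<and> ?Q S w = ?t S"
    and max: "sum c S = 1 \<Longrightarrow> ?Q S c \<le> ?t S"
    if S: "S \<noteq> {}" "S \<subseteq> verts G" for S c
  proof -
    have sym: "tree_dist G \<alpha> u v = tree_dist G \<alpha> v u" if "u \<in> S" "v \<in> S" for u v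
      using tree_dist_commute[OF G] that S by auto
    note neg = cond_neg_def_tree_dist[OF G \<alpha> S(2)]
    from S obtain b k where b: "bij_betw b {..<k} S" and
      M: "principal_submatrix D vs S = mat k k (\<lambda>(i, j). tree_dist G \<alpha> (b i) (b j))"
      using principal_submatrix_distance_matrix[OF assms(3)] assms(4) unfolding D_def by metis
    from det_div_cof_equilibrium[OF b S(1) sym neg] obtain w
      where w: "sum w S = 1" "\<forall>u\<in>S. (\<Sum>v\<in>S. tree_dist G \<alpha> u v * w v) = ?t S"
      unfolding M by blast
    show "sum c S = 1 \<Longrightarrow> ?Q S c \<le> ?t S"
      by (rule quadratic_form_le_equilibrium[OF neg sym w])
    have "?Q S w = (\<Sum>u\<in>S. w u * (\<Sum>v\<in>S. tree_dist G \<alpha> u v * w v))"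
      by (simp add: sum_distrib_left mult_ac)
    also have "\<dots> = sum w S * ?t S" unfolding sum_distrib_right by (intro sum.cong) (use w(2) in auto)
    finally show "\<exists>w. sum w S = 1 \<and> ?Q S w = ?t S" using w(1) by auto
  qed
  show ?thesis
  proof (intro conjI allI impI; (elim conjE)?)
    fix S assume S: "S \<noteq> {}" "S \<subseteq> verts G"
    from attained[OF S] obtain w where "sum w S = 1" "?Q S w = ?t S" by blast
    then show "?t S \<le> 1 / 2 * (\<Sum>e\<in>edges (conv_hull S G). \<alpha> e)"
      using tree_dist_quadratic_form_le[OF G \<alpha> S(2), of w] by simp
  next
    fix S s0 s1 \<gamma>
    assume S: "S \<subseteq> verts G" and s: "s0 \<in> S" "s1 \<in> S" and \<gamma>: "simple_path G s0 \<gamma> s1"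
    have fin: "finite S" using S G by (auto simp: finite_tree_def intro: finite_subset)
    \<comment> \<open>For \<open>s0 = s1\<close> the two halves add up to weight 1 at one vertex, so
      the path of length zero is covered too.\<close>
    define c where "c u = (of_bool (u = s0) + of_bool (u = s1)) / (2 :: real)" for u
    have pick: "(\<Sum>u\<in>S. c u * f u) = (f s0 + f s1) / 2" for f :: "'a \<Rightarrow> real"
      using fin s by (simp add: c_def sum_divide_distrib[symmetric] distrib_right sum.distrib)
    have "sum c S = 1" using pick[of "\<lambda>_. 1"] by simp
    then have "?Q S c \<le> ?t S" using max[of S c] s S by auto
    moreover have "?Q S c = (\<Sum>u\<in>S. c u * (\<Sum>v\<in>S. c v * tree_dist G \<alpha> u v))"
      by (simp add: sum_distrib_left mult_ac)
    \<comment> \<open>The diagonal distances vanish, and the two equal mixed ones, each with weight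
      1/4, give half the distance from \<open>s0\<close> to \<open>s1\<close>.\<close>
    then have "?Q S c = ((tree_dist G \<alpha> s0 s0 + tree_dist G \<alpha> s0 s1) / 2
        + (tree_dist G \<alpha> s1 s0 + tree_dist G \<alpha> s1 s1) / 2) / 2"
      by (simp only: pick)
    moreover have "s0 \<in> verts G" "s1 \<in> verts G" using s S by auto
    ultimately have "tree_dist G \<alpha> s0 s1 / 2 \<le> ?t S"
      using tree_dist_commute[OF G, of s0 s1 \<alpha>] tree_dist_self[OF G]
      by simp
    then show "1 / 2 * (\<Sum>e\<in>path_edges \<gamma>. \<alpha> e) \<le> ?t S"
      using tree_dist_eq[OF G \<gamma>, of \<alpha>] by simp
  qed
qed

end
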